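(* For every S-semigroup $S$ there exists a set $N$ such that the semigroup $S(N)$ of all maps from $N$ to itself (under composition) is an S-semigroup, and there exists an S-semigroup isomorphism from $S$ to $S(N)$.
   Context: An S-semigroup (Smarandache semigroup) is a semigroup $S$ having a proper subset $A \subsetneq S$ that is a group with respect to the operation of $S$ (its identity need not be an identity of $S$). Following the paper's usage, a one-element group is not counted. A "subgroup of $S$" means such a proper subset (with at least two elements). For S-semigroups $S, S'$, a map $\phi: S \to S'$ is an S-semigroup homomorphism if there are subgroups $A \subset S$ and $A' \subset S'$ such that $\phi$ restricts to a group homomorphism $A \to A'$. It is an S-semigroup isomorphism if moreover this restriction $\phi|_A : A \to A'$ is one-to-one and onto. (No condition is imposed on $\phi$ outside $A$.) *)

theory Defs
  imports "HOL-Algebra.Group"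
begin

record 'a magma = "'a partial_object" +
  op :: "'a \<Rightarrow> 'a \<Rightarrow> 'a"

definition is_semigroup :: "'a magma \<Rightarrow> bool" where
  "is_semigroup S \<longleftrightarrow>
     (\<forall>x \<in> carrier S. \<forall>y \<in> carrier S. op S x y \<in> carrier S) \<and>
     (\<forall>x \<in> carrier S. \<forall>y \<in> carrier S. \<forall>z \<in> carrier S.
        op S (op S x y) z = op S x (op S y z))"

text \<open>
  A subgroup of a semigroup is given as a group record, whose identity is its own and need not
  be an identity of the semigroup. It is a proper subset, and one-element groups are excluded.
\<close>

definition subgroup_of :: "'a monoid \<Rightarrow> 'a magma \<Rightarrow> bool" where
  "subgroup_of A S \<longleftrightarrow>
     group A \<and> carrier A \<subset> carrier S \<and> mult A = op S \<and>
     (\<exists>x \<in> carrier A. \<exists>y \<in> carrier A. x \<noteq> y)"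

definition S_semigroup :: "'a magma \<Rightarrow> bool" where
  "S_semigroup S \<longleftrightarrow> is_semigroup S \<and> (\<exists>A. subgroup_of A S)"

text \<open>
  The maps below are constrained only on the chosen subgroup: membership in \<^const>\<open>hom\<close> and
  \<^const>\<open>iso\<close> depends only on the values on the carrier of the first group.
\<close>

definition S_hom :: "'a magma \<Rightarrow> 'b magma \<Rightarrow> ('a \<Rightarrow> 'b) set" where
  "S_hom S S' = {\<phi> \<in> carrier S \<rightarrow> carrier S'.
     \<exists>A A'. subgroup_of A S \<and> subgroup_of A' S' \<and> \<phi> \<in> hom A A'}"

definition S_iso :: "'a magma \<Rightarrow> 'b magma \<Rightarrow> ('a \<Rightarrow> 'b) set" where
  "S_iso S S' = {\<phi> \<in> carrier S \<rightarrow> carrier S'.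
     \<exists>A A'. subgroup_of A S \<and> subgroup_of A' S' \<and> \<phi> \<in> iso A A'}"

text \<open>
  Self-maps of a set are represented by functions that are \<^const>\<open>undefined\<close> outside it.
\<close>

definition self_maps :: "'b set \<Rightarrow> ('b \<Rightarrow> 'b) magma" where
  "self_maps N = \<lparr>carrier = N \<rightarrow>\<^sub>E N, op = compose N\<rparr>"

end

theory Submission
  imports Defs
begin

text \<open>
  The result is Cayley's theorem. An S-isomorphism is constrained only on one subgroup, so it
  suffices to embed a single subgroup \<open>A\<close> of \<open>S\<close> into the self-maps of some set. Its left
  regular representation does this with \<open>N\<close> the carrier of \<open>A\<close>: translations multiply like group
  elements, and a translation determines its element as the image of the identity. Outside \<open>A\<close>
  any values in \<open>S(N)\<close> will do.

  The image must moreover be a \<^emph>\<open>proper\<close> subset of \<open>S(N)\<close>. It is, because translations are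
  injective, while a constant map on a set with at least two points is not.
\<close>

definition left_translation :: "('a, 'm) monoid_scheme \<Rightarrow> 'a \<Rightarrow> 'a \<Rightarrow> 'a" where
  "left_translation G a = (\<lambda>x \<in> carrier G. a \<otimes>\<^bsub>G\<^esub> x)"

definition left_translation_group :: "('a, 'm) monoid_scheme \<Rightarrow> ('a \<Rightarrow> 'a) monoid" where
  "left_translation_group G =
     \<lparr>carrier = left_translation G ` carrier G, mult = compose (carrier G),
      one = left_translation G \<one>\<^bsub>G\<^esub>\<rparr>"

lemma is_semigroup_self_maps: "is_semigroup (self_maps (N :: 'b set))"
proof -
  have "compose N f g \<in> N \<rightarrow>\<^sub>E N" if "f \<in> N \<rightarrow>\<^sub>E N" "g \<in> N \<rightarrow>\<^sub>E N" for f g :: "'b \<Rightarrow> 'b"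
    using that by (auto simp: PiE_def compose_eq)
  moreover have "compose N (compose N f g) h = compose N f (compose N g h)"
    if "h \<in> N \<rightarrow>\<^sub>E N" for f g h :: "'b \<Rightarrow> 'b"
    using that by (auto simp: PiE_def intro!: compose_assoc [symmetric])
  ultimately show ?thesis
    by (simp add: is_semigroup_def self_maps_def)
qed

lemma (in monoid) left_translation_in_PiE:
  "a \<in> carrier G \<Longrightarrow> left_translation G a \<in> carrier G \<rightarrow>\<^sub>E carrier G"
  by (auto simp: left_translation_def)

lemma (in monoid) left_translation_mult:
  assumes "a \<in> carrier G" "b \<in> carrier G"
  shows "left_translation G (a \<otimes> b) =
    compose (carrier G) (left_translation G a) (left_translation G b)"
  using assms by (auto simp: left_translation_def compose_def m_assoc fun_eq_iff)

text \<open>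
  The regular representation is faithful: evaluating the translation by \<open>a\<close> at the identity
  recovers \<open>a\<close>.
\<close>

lemma (in monoid) inj_on_left_translation: "inj_on (left_translation G) (carrier G)"
proof (rule inj_onI)
  fix a b
  assume ab: "a \<in> carrier G" "b \<in> carrier G" "left_translation G a = left_translation G b"
  then have "left_translation G a \<one> = left_translation G b \<one>"
    by simp
  with ab(1,2) show "a = b"
    by (simp add: left_translation_def)
qed

lemma (in monoid) left_translation_iso:
  "left_translation G \<in> iso G (left_translation_group G)"
  by (auto simp: iso_def hom_def bij_betw_def left_translation_group_def inj_on_left_translation
      left_translation_mult)

lemma (in group) group_left_translation_group: "group (left_translation_group G)"
proof -
  let ?T = "left_translation_group G"
  have "left_translation G \<in> hom G ?T"
    using left_translation_iso by (simp add: iso_def)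
  then have "group (?T\<lparr>carrier := left_translation G ` carrier G,
      one := left_translation G \<one>\<rparr>)"
    by (rule hom_imp_img_group)
  then show ?thesis
    by (simp add: left_translation_group_def)
qed

text \<open>
  Properness is where the exclusion of the one-element group enters: on a single point the only
  self-map is the identity, which is a translation. With two distinct points, the constant map
  with value the identity cannot be a translation, by cancellation.
\<close>

lemma (in group) subgroup_of_left_translation_group:
  assumes "x \<in> carrier G" "y \<in> carrier G" "x \<noteq> y"
  shows "subgroup_of (left_translation_group G) (self_maps (carrier G))"
proof -
  let ?c = "\<lambda>z \<in> carrier G. \<one>"
  have "?c \<noteq> left_translation G a" if a: "a \<in> carrier G" for a
  proof
    assume "?c = left_translation G a"
    then have "?c x = left_translation G a x" "?c y = left_translation G a y"
      by simp_all
    then have "a \<otimes> x = a \<otimes> y"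
      using assms by (simp add: left_translation_def)
    then show False
      using a assms by simp
  qed
  then have "?c \<notin> left_translation G ` carrier G"
    by blast
  moreover have "?c \<in> carrier G \<rightarrow>\<^sub>E carrier G"
    by auto
  ultimately have "left_translation G ` carrier G \<subset> carrier G \<rightarrow>\<^sub>E carrier G"
    using left_translation_in_PiE by blast
  moreover have "left_translation G x \<noteq> left_translation G y"
    using assms by (simp add: inj_on_eq_iff [OF inj_on_left_translation])
  ultimately show ?thesis
    using assms(1,2) group_left_translation_group
    unfolding subgroup_of_def self_maps_def
    by (simp add: left_translation_group_def) blast
qed

theorem theorem5p2p1:
  fixes S :: "'a magma"
  assumes "S_semigroup S"
  shows "\<exists>N :: 'a set. S_semigroup (self_maps N) \<and> (\<exists>\<phi>. \<phi> \<in> S_iso S (self_maps N))"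
proof -
  obtain A where A: "subgroup_of A S"
    using assms by (auto simp: S_semigroup_def)
  then obtain x y where xy: "x \<in> carrier A" "y \<in> carrier A" "x \<noteq> y"
    by (auto simp: subgroup_of_def)
  interpret A: group A
    using A by (simp add: subgroup_of_def)
  let ?N = "carrier A"
  let ?T = "left_translation_group A"
  have T: "subgroup_of ?T (self_maps ?N)"
    using xy by (rule A.subgroup_of_left_translation_group)
  \<comment> \<open>The value outside \<open>A\<close> is arbitrary; sending everything there to the translation by the
    identity keeps \<open>\<phi>\<close> inside \<open>S(N)\<close>.\<close>
  define \<phi> where
    "\<phi> s = left_translation A (if s \<in> ?N then s else \<one>\<^bsub>A\<^esub>)" for s
  have "\<phi> \<in> carrier S \<rightarrow> carrier (self_maps ?N)"
    using A.left_translation_in_PiE by (simp add: \<phi>_def self_maps_def)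
  moreover have "\<phi> \<in> iso A ?T"
    using A.left_translation_iso by (rule A.iso_eq) (simp add: \<phi>_def)
  ultimately have "\<phi> \<in> S_iso S (self_maps ?N)"
    using A T unfolding S_iso_def by blast
  moreover have "S_semigroup (self_maps ?N)"
    using T is_semigroup_self_maps unfolding S_semigroup_def by blast
  ultimately show ?thesis
    by blast
qed

end
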